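(* Let $n$ be a positive integer and let $S$ denote one of the semigroups $\mathrm{M}^0_n$, $\tilde{\mathrm{M}}^0_n$, or $\Omega_n$ (under matrix multiplication). Then: (a) The semigroup $S$ contains exactly $n!$ maximal nilpotent subsemigroups, each of nilpotency class $n$. These subsemigroups are in a natural bijection (made explicit in (b)) with linear orders on the set $\{1,2,\dots,n\}$. (b) The maximal nilpotent subsemigroup of $S$ which corresponds to the linear order $i_1\prec i_2\prec\dots\prec i_n$ has the form $$T=\{(a_{k,l})\in S: a_{k,l}\neq 0\Rightarrow k\prec l\}.$$ (c) Let the maximal nilpotent subsemigroups $T_1$ and $T_2$ of $S$ correspond to the linear orders $i_1\prec_1 i_2\prec_1\dots\prec_1 i_n$ and $j_1\prec_2 j_2\prec_2\dots\prec_2 j_n$ respectively. Then $T_2=M^{-1}T_1M$, where $M=(m_{i,j})$ is the $(0,1)$-matrix such that $m_{i,j}=1$ if and only if $j=\pi(i)$, where $\pi$ is the permutation of $\{1,\dots,n\}$ with $\pi(i_s)=j_s$ for all $s=1,\dots,n$. In particular, all maximal nilpotent subsemigroups of $S$ are isomorphic. (d) For every $k\in\mathbb{N}$, $k<n$, the semigroup $S$ contains exactly $\sum_{i=0}^{k-1}(-1)^i\binom{k}{i}(k-i)^n$ maximal nilpotent subsemigroups of nilpotency class $k$. These are in a natural bijection (made explicit in (e)) with decompositions of the set $\{1,2,\dots,n\}$ into an ordered union of $k$ pairwise disjoint and non-empty blocks. (e) Let $N_1\cup\dots\cup N_k=\{1,\dots,n\}$ be a decomposition into an ordered union of pairwise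 disjoint non-empty blocks. Then the maximal nilpotent subsemigroup of nilpotency class $k$ of $S$ which corresponds to this decomposition is $$T=\{(a_{i,j})\in S: a_{i,j}\neq 0\text{ and }i\in N_p,\ j\in N_q\Rightarrow p<q\}.$$
   Context: $\Omega_n$ is the semigroup of all $n\times n$ real matrices with non-negative entries. $\mathrm{M}^0_n$ is the semigroup of all real $n\times n$ matrices each row and each column of which contains at most one non-zero entry. $\tilde{\mathrm{M}}^0_n=\mathrm{M}^0_n\cap\Omega_n$. In each case the operation is matrix multiplication and the zero element is the zero matrix. $\mathbb{N}=\{1,2,3,\dots\}$. Let $S$ be a semigroup with zero element $0$. A (non-empty) subsemigroup $T\subset S$ is nilpotent if there is $k\in\mathbb{N}$ with $T^k=\{0\}$ (every product of $k$ elements of $T$ equals $0$); the minimal such $k$ is the nilpotency class of $T$. $\mathrm{Nil}_m(S)$ denotes the set of all nilpotent subsemigroups of $S$ of nilpotency class at most $m$, and $\mathrm{Nil}(S)=\bigcup_{m\in\mathbb{N}}\mathrm{Nil}_m(S)$. The maximal elements of $\mathrm{Nil}_m(S)$ with respect to inclusion are called maximal nilpotent subsemigroups of nilpotency class $m$ of $S$. The maximal elements of $\mathrm{Nil}(S)$ with respect to inclusion are called maximal nilpotent subsemigroups of $S$. *)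

theory Defs
  imports "HOL-Analysis.Analysis"
begin

section \<open>Nilpotent subsemigroups of a semigroup with zero\<close>

text \<open>
  A semigroup with zero is given by a carrier set \<open>S\<close>, an operation \<open>mul\<close> and
  a zero element \<open>z\<close>. The power \<open>set_power mul T k\<close> is only meaningful for \<open>k \<ge> 1\<close>; the value at
  \<open>0\<close> is a dummy.
\<close>

fun set_power :: "('a \<Rightarrow> 'a \<Rightarrow> 'a) \<Rightarrow> 'a set \<Rightarrow> nat \<Rightarrow> 'a set" where
  "set_power mul T 0 = {}"
| "set_power mul T (Suc 0) = T"
| "set_power mul T (Suc (Suc k)) =
     {mul a b | a b. a \<in> set_power mul T (Suc k) \<and> b \<in> T}"

definition subsemigroup_of :: "('a \<Rightarrow> 'a \<Rightarrow> 'a) \<Rightarrow> 'a set \<Rightarrow> 'a set \<Rightarrow> bool" where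
  "subsemigroup_of mul S T \<longleftrightarrow>
     T \<noteq> {} \<and> T \<subseteq> S \<and> (\<forall>a\<in>T. \<forall>b\<in>T. mul a b \<in> T)"

definition nilpotent_set :: "('a \<Rightarrow> 'a \<Rightarrow> 'a) \<Rightarrow> 'a \<Rightarrow> 'a set \<Rightarrow> bool" where
  "nilpotent_set mul z T \<longleftrightarrow> (\<exists>k\<ge>1. set_power mul T k = {z})"

text \<open>Only meaningful if \<open>nilpotent_set mul z T\<close>.\<close>

definition nilpotency_class :: "('a \<Rightarrow> 'a \<Rightarrow> 'a) \<Rightarrow> 'a \<Rightarrow> 'a set \<Rightarrow> nat" where
  "nilpotency_class mul z T = (LEAST k. 1 \<le> k \<and> set_power mul T k = {z})"

definition Nil_upto :: "('a \<Rightarrow> 'a \<Rightarrow> 'a) \<Rightarrow> 'a \<Rightarrow> 'a set \<Rightarrow> nat \<Rightarrow> 'a set set" where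
  "Nil_upto mul z S m =
     {T. subsemigroup_of mul S T \<and> nilpotent_set mul z T \<and> nilpotency_class mul z T \<le> m}"

definition Nil_all :: "('a \<Rightarrow> 'a \<Rightarrow> 'a) \<Rightarrow> 'a \<Rightarrow> 'a set \<Rightarrow> 'a set set" where
  "Nil_all mul z S = (\<Union>m\<in>{1..}. Nil_upto mul z S m)"

definition maximal_elements :: "'a set set \<Rightarrow> 'a set set" where
  "maximal_elements F = {T \<in> F. \<forall>T'\<in>F. T \<subseteq> T' \<longrightarrow> T' = T}"

definition max_nilpotent :: "('a \<Rightarrow> 'a \<Rightarrow> 'a) \<Rightarrow> 'a \<Rightarrow> 'a set \<Rightarrow> 'a set set" where
  "max_nilpotent mul z S = maximal_elements (Nil_all mul z S)"

text \<open>
  The maximal nilpotent subsemigroups of nilpotency class \<open>m\<close> are by definition the maximal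
  elements among the nilpotent subsemigroups of class at most \<open>m\<close>.
\<close>

definition max_nilpotent_class ::
    "('a \<Rightarrow> 'a \<Rightarrow> 'a) \<Rightarrow> 'a \<Rightarrow> 'a set \<Rightarrow> nat \<Rightarrow> 'a set set" where
  "max_nilpotent_class mul z S m = maximal_elements (Nil_upto mul z S m)"

definition semigroup_isomorphic :: "('a \<Rightarrow> 'a \<Rightarrow> 'a) \<Rightarrow> 'a set \<Rightarrow> 'a set \<Rightarrow> bool" where
  "semigroup_isomorphic mul T1 T2 \<longleftrightarrow>
     (\<exists>f. bij_betw f T1 T2 \<and> (\<forall>a\<in>T1. \<forall>b\<in>T1. f (mul a b) = mul (f a) (f b)))"

section \<open>The matrix semigroups\<close>

text \<open>
  The index set \<open>{1, \<dots>, n}\<close> is the universe of a finite type \<open>'n\<close>, so \<open>n = CARD('n)\<close>.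
  The operation on all three semigroups is matrix multiplication \<open>matrix_matrix_mult\<close>
  (the library's \<open>*\<close> on these types is not the matrix product).
\<close>

definition Omega_mat :: "(real^'n^'n) set" where
  "Omega_mat = {A. \<forall>i j. A $ i $ j \<ge> 0}"

definition M0_mat :: "(real^'n^'n) set" where
  "M0_mat = {A. (\<forall>i j j'. A $ i $ j \<noteq> 0 \<and> A $ i $ j' \<noteq> 0 \<longrightarrow> j = j') \<and>
                (\<forall>i i' j. A $ i $ j \<noteq> 0 \<and> A $ i' $ j \<noteq> 0 \<longrightarrow> i = i')}"

definition M0_nonneg_mat :: "(real^'n^'n) set" where
  "M0_nonneg_mat = M0_mat \<inter> Omega_mat"

section \<open>Linear orders and ordered decompositions\<close>

text \<open>Linear orders are represented by their strict part: \<open>(k, l) \<in> r\<close> means \<open>k \<prec> l\<close>.\<close>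

definition linear_orders :: "'n rel set" where
  "linear_orders = {r. strict_linear_order_on UNIV r}"

text \<open>\<open>enumerates i r\<close> says that \<open>r\<close> is the order \<open>i 1 \<prec> i 2 \<prec> \<dots> \<prec> i n\<close>.\<close>

definition enumerates :: "(nat \<Rightarrow> 'n) \<Rightarrow> 'n rel \<Rightarrow> bool" where
  "enumerates i r \<longleftrightarrow>
     bij_betw i {1..CARD('n)} UNIV \<and>
     (\<forall>s\<in>{1..CARD('n)}. \<forall>t\<in>{1..CARD('n)}. (i s, i t) \<in> r \<longleftrightarrow> s < t)"

definition order_semigroup :: "(real^'n^'n) set \<Rightarrow> 'n rel \<Rightarrow> (real^'n^'n) set" where
  "order_semigroup S r = {A \<in> S. \<forall>k l. A $ k $ l \<noteq> 0 \<longrightarrow> (k, l) \<in> r}"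

definition perm_mat :: "('n \<Rightarrow> 'n) \<Rightarrow> real^'n^'n" where
  "perm_mat \<pi> = (\<chi> i j. if j = \<pi> i then 1 else 0)"

text \<open>
  A decomposition into an ordered union of \<open>k\<close> blocks is the family \<open>N 1, \<dots>, N k\<close>,
  taken extensional outside \<open>{1..k}\<close> so that different functions are different decompositions.
\<close>

definition ordered_decompositions :: "nat \<Rightarrow> (nat \<Rightarrow> 'n set) set" where
  "ordered_decompositions k =
     {N \<in> {1..k} \<rightarrow>\<^sub>E UNIV. (\<forall>p\<in>{1..k}. N p \<noteq> {}) \<and> disjoint_family_on N {1..k} \<and>
        (\<Union>p\<in>{1..k}. N p) = UNIV}"

definition block_semigroup ::
    "(real^'n^'n) set \<Rightarrow> nat \<Rightarrow> (nat \<Rightarrow> 'n set) \<Rightarrow> (real^'n^'n) set" where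
  "block_semigroup S k N =
     {A \<in> S. \<forall>i j. \<forall>p\<in>{1..k}. \<forall>q\<in>{1..k}.
        A $ i $ j \<noteq> 0 \<and> i \<in> N p \<and> j \<in> N q \<longrightarrow> p < q}"

end

theory Submission
  imports Defs
begin

text \<open>
  In each of the three semigroups a product of matrices has no cancellation, so the product of
  \<open>k\<close> elements of a subsemigroup \<open>T\<close> is always zero iff the relation of all positions of non-zero
  entries of elements of \<open>T\<close> has no walk of length \<open>k\<close>, that is, iff it is compatible with a level
  function with at most \<open>k\<close> values. For \<open>k \<le> n\<close> the levels can be split until exactly \<open>k\<close> of them
  are in use; two surjective level functions onto \<open>{1..k}\<close> whose orders are nested are equal
  (compare them along a chain through all levels). So the maximal subsemigroups of class \<open>k\<close>
  correspond to the surjections onto \<open>{1..k}\<close>, which are the ordered decompositions, and for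
  \<open>k = n\<close> are the linear orders. A nilpotent subsemigroup of any class has an acyclic support
  relation, hence class at most \<open>n\<close>.
\<close>

section \<open>Level functions\<close>

text \<open>A strict weak order: its classes of incomparable points are the fibres of
  \<open>h\<close>.\<close>

definition level_order :: "('a \<Rightarrow> nat) \<Rightarrow> 'a rel" where
  "level_order h = {(i, j). h i < h j}"

lemma in_level_order [simp]: "(i, j) \<in> level_order h \<longleftrightarrow> h i < h j"
  by (simp add: level_order_def)

text \<open>A strictly increasing \<open>f\<close> gains at least one per step. Counting up from
  \<open>1 \<le> f 1\<close> keeps it on or above the diagonal, counting down from
  \<open>f k \<le> k\<close> on or below.\<close>

lemma strict_mono_on_atLeastAtMost_self:
  fixes f :: "nat \<Rightarrow> nat"
  assumes mono: "strict_mono_on {1..k} f" and img: "f ` {1..k} \<subseteq> {1..k}" and p: "p \<in> {1..k}"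
  shows "f p = p"
proof -
  have lower: "q \<le> k \<longrightarrow> q \<le> f q" if "1 \<le> q" for q
    using that
  proof (induction q rule: dec_induct)
    case base
    then show ?case using img by force
  next
    case (step q)
    then show ?case
      using strict_mono_onD[OF mono, of q "Suc q"] by force
  qed
  have upper: "1 \<le> q \<longrightarrow> f q \<le> q" if "q \<le> k" for q
    using that
  proof (induction q rule: inc_induct)
    case base
    then show ?case using img by force
  next
    case (step q)
    then show ?case
      using strict_mono_onD[OF mono, of q "Suc q"] by force
  qed
  show ?thesis using lower[of p] upper[of p] p by force
qed

text \<open>Along one representative of each \<open>g\<close>-level, in increasing order,
  \<open>h\<close> increases strictly within \<open>{1..k}\<close>, hence is the identity there.
  This rigidity gives both injectivity of the parametrisations and the antichain property.\<close>

lemma level_order_subset_imp_eq: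
  assumes g: "range g = {1..k}" and h: "range h = {1..k}"
    and sub: "level_order g \<subseteq> level_order h"
  shows "g = h"
proof
  fix x
  \<comment> \<open>\<open>inv g\<close> picks the representatives; the update makes the chain pass
    through the given \<open>x\<close>.\<close>
  define chain where "chain = (inv g)(g x := x)"
  have g_chain: "g (chain p) = p" if "p \<in> {1..k}" for p
    using that g by (auto simp: chain_def f_inv_into_f)
  have h_mem: "h y \<in> {1..k}" for y using h by blast
  have "strict_mono_on {1..k} (h \<circ> chain)"
  proof (rule strict_mono_onI)
    fix p q assume "p \<in> {1..k}" "q \<in> {1..k}" "p < q"
    then have "(chain p, chain q) \<in> level_order g" by (simp add: g_chain del: atLeastAtMost_iff)
    then have "(chain p, chain q) \<in> level_order h" using sub by blast
    then show "(h \<circ> chain) p < (h \<circ> chain) q" by simp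
  qed
  then have "(h \<circ> chain) (g x) = g x"
    by (rule strict_mono_on_atLeastAtMost_self) (use h_mem g in auto)
  then show "g x = h x" by (simp add: chain_def)
qed

text \<open>Replacing each value by its rank among the values taken closes all gaps and keeps the
  order.\<close>

lemma level_order_compress:
  fixes g :: "'a::finite \<Rightarrow> nat"
  obtains h where "range h = {1..card (range g)}" "level_order g \<subseteq> level_order h"
proof
  define r where "r v = card {w \<in> range g. w \<le> v}" for v
  have mono: "r v < r w" if "w \<in> range g" "v < w" for v w
    unfolding r_def
  proof (rule psubset_card_mono)
    have "w \<in> {u \<in> range g. u \<le> w} - {u \<in> range g. u \<le> v}" using that by simp
    moreover have "{u \<in> range g. u \<le> v} \<subseteq> {u \<in> range g. u \<le> w}" using that by auto
    ultimately show "{u \<in> range g. u \<le> v} \<subset> {u \<in> range g. u \<le> w}" by blast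
  qed simp
  have "strict_mono_on (range g) r" by (rule strict_mono_onI) (rule mono)
  then have "inj_on r (range g)" by (rule strict_mono_on_imp_inj_on)
  moreover have "1 \<le> r v" if "v \<in> range g" for v
  proof -
    have "{w \<in> range g. w \<le> v} \<noteq> {}" using that by auto
    then have "0 < r v" unfolding r_def by (subst card_gt_0_iff) auto
    then show ?thesis by simp
  qed
  moreover have "r v \<le> card (range g)" for v
    unfolding r_def by (rule card_mono) auto
  ultimately have "r ` range g = {1..card (range g)}"
    by (intro card_subset_eq) (auto simp: card_image)
  then show "range (r \<circ> g) = {1..card (range g)}"
    by (simp add: image_comp)
  show "level_order g \<subseteq> level_order (r \<circ> g)"
    using mono by auto
qed

text \<open>With fewer levels than points some level holds two points \<open>a\<close> and
  \<open>b\<close>; \<open>a\<close> is moved to a new level directly above it.\<close>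

lemma level_order_split:
  fixes g :: "'a::finite \<Rightarrow> nat"
  assumes g: "range g = {1..m}" and less: "m < CARD('a)"
  obtains h where "range h = {1..Suc m}" "level_order g \<subseteq> level_order h"
proof -
  have "\<not> inj g"
    using g less by (metis card_image card_atLeastAtMost diff_Suc_1 less_irrefl)
  then obtain a b where ab: "g a = g b" "a \<noteq> b" by (auto simp: inj_on_def)
  \<comment> \<open>All levels above \<open>g a\<close> shift up by one to make room for
    \<open>a\<close>; the old level stays occupied by \<open>b\<close>.\<close>
  define h where "h x = (if g x < g a \<or> g x = g a \<and> x \<noteq> a then g x else Suc (g x))" for x
  have "v \<in> range h" if v: "v \<in> {1..Suc m}" for v
  proof -
    consider "v < g a" | "v = g a" | "v = Suc (g a)" | "Suc (g a) < v" by linarith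
    then show ?thesis
    proof cases
      case 1
      then have "v \<in> range g" using v g by (metis atLeastAtMost_iff le_trans less_imp_le rangeI)
      then show ?thesis using 1 by (auto simp: h_def image_iff)
    next
      case 2
      then show ?thesis using ab by (auto simp: h_def image_iff intro!: exI[of _ b])
    next
      case 3
      then show ?thesis by (auto simp: h_def image_iff intro!: exI[of _ a])
    next
      case 4
      then have "v - 1 \<in> range g" using v g by auto
      then obtain x where "g x = v - 1" by auto
      then show ?thesis using 4 by (auto simp: h_def image_iff intro!: exI[of _ x])
    qed
  qed
  moreover have "h x \<in> {1..Suc m}" for x
  proof -
    have "g x \<in> {1..m}" using g by blast
    then show ?thesis by (auto simp: h_def)
  qed
  ultimately have "range h = {1..Suc m}" by blast
  moreover have "level_order g \<subseteq> level_order h" by (auto simp: h_def)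
  ultimately show thesis by (rule that)
qed

lemma level_order_refine:
  fixes g :: "'a::finite \<Rightarrow> nat"
  assumes "card (range g) \<le> k" "k \<le> CARD('a)"
  shows "\<exists>h. range h = {1..k} \<and> level_order g \<subseteq> level_order h"
  using assms
proof (induction k rule: dec_induct)
  case base
  show ?case by (rule level_order_compress[of g]) blast
next
  case (step k)
  then obtain h where h: "range h = {1..k}" "level_order g \<subseteq> level_order h" by auto
  from level_order_split[OF h(1)] step.prems
  obtain h' where "range h' = {1..Suc k}" "level_order h \<subseteq> level_order h'" by auto
  then show ?case using h(2) by blast
qed

text \<open>The level of \<open>x\<close> is the length of a longest walk ending in
  \<open>x\<close>. It is below \<open>k\<close> because a walk of length at least \<open>k\<close>
  contains one of length exactly \<open>k\<close>.\<close>

lemma relpow_empty_imp_level_function: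
  assumes empty: "(R :: 'a rel) ^^ k = {}"
  obtains g :: "'a \<Rightarrow> nat" where "\<And>x. g x < k" "R \<subseteq> level_order g"
proof
  define M where "M x = {m. \<exists>w. (w, x) \<in> R ^^ m}" for x
  have bound: "m < k" if "m \<in> M x" for m x
  proof (rule ccontr)
    assume "\<not> m < k"
    then have "R ^^ m = R ^^ k O R ^^ (m - k)" by (simp flip: relpow_add)
    then show False using that empty by (auto simp: M_def)
  qed
  have M: "finite (M x)" "M x \<noteq> {}" for x
  proof -
    show "finite (M x)" using bound by (meson finite_nat_iff_bounded lessThan_iff subsetI)
    have "0 \<in> M x" by (simp add: M_def)
    then show "M x \<noteq> {}" by blast
  qed
  show "Max (M x) < k" for x using M bound by (meson Max_in)
  show "R \<subseteq> level_order (\<lambda>x. Max (M x))"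
  proof (clarsimp)
    fix x y assume "(x, y) \<in> R"
    moreover obtain w where "(w, x) \<in> R ^^ Max (M x)"
      using Max_in[OF M[of x]] by (auto simp: M_def)
    \<comment> \<open>A longest walk to \<open>x\<close> is extended by the edge from
      \<open>x\<close> to \<open>y\<close>.\<close>
    ultimately have "Suc (Max (M x)) \<in> M y" by (auto simp: M_def)
    then show "Max (M x) < Max (M y)" using M by (meson Max_ge Suc_le_lessD)
  qed
qed

section \<open>Counting level functions\<close>

text \<open>Inclusion-exclusion: the functions into \<open>V\<close> are sorted by their exact
  range, the resulting sum over subsets is inverted, and subsets of equal size are
  collected.\<close>

lemma card_functions_onto:
  "int (card {h :: 'a::finite \<Rightarrow> nat. range h = {1..k}}) =
     (\<Sum>i=0..k. (-1) ^ i * int (k choose i) * (int k - int i) ^ CARD('a))"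
proof -
  define f where "f V = int (card {h :: 'a \<Rightarrow> nat. range h = V})" for V
  have count: "int (card V) ^ CARD('a) = sum f (Pow V)" if "finite V" for V
  proof -
    have fin: "finite {h :: 'a \<Rightarrow> nat. range h \<subseteq> V}"
      using finite_PiE[of "UNIV :: 'a set" "\<lambda>_. V"] that
      by (simp add: PiE_def extensional_def Pi_def image_subset_iff)
    have "card {h :: 'a \<Rightarrow> nat. range h \<subseteq> V} = card V ^ CARD('a)"
      using card_funcsetE[of "UNIV :: 'a set" V]
      by (simp add: PiE_def extensional_def Pi_def image_subset_iff)
    moreover have "{h :: 'a \<Rightarrow> nat. range h \<subseteq> V} = (\<Union>W\<in>Pow V. {h. range h = W})" by auto
    moreover have "card (\<Union>W\<in>Pow V. {h :: 'a \<Rightarrow> nat. range h = W}) =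
        (\<Sum>W\<in>Pow V. card {h :: 'a \<Rightarrow> nat. range h = W})"
      by (rule card_UN_disjoint)
        (use that in \<open>auto intro: finite_subset[OF _ fin]\<close>)
    ultimately have "card V ^ CARD('a) = (\<Sum>W\<in>Pow V. card {h :: 'a \<Rightarrow> nat. range h = W})"
      by (simp only:)
    then show ?thesis
      unfolding f_def by (simp only: flip: of_nat_power of_nat_sum)
  qed
  have "f {1..k} = (\<Sum>W\<in>Pow {1..k}. (-1) ^ (k - card W) * int (card W) ^ CARD('a))"
    using inclusion_exclusion_mobius[of "\<lambda>V. int (card V) ^ CARD('a)" f "{1..k}"] count by simp
  also have "\<dots> = (\<Sum>j\<in>{0..k}. \<Sum>W | W \<in> Pow {1..k} \<and> card W = j.
      (-1) ^ (k - card W) * int (card W) ^ CARD('a))"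
    by (rule sum.group[symmetric]) (auto dest: card_mono[rotated])
  also have "\<dots> = (\<Sum>j\<in>{0..k}. int (k choose j) * ((-1) ^ (k - j) * int j ^ CARD('a)))"
  proof (rule sum.cong)
    fix j
    show "(\<Sum>W | W \<in> Pow {1..k} \<and> card W = j. (-1) ^ (k - card W) * int (card W) ^ CARD('a)) =
        int (k choose j) * ((-1) ^ (k - j) * int j ^ CARD('a))"
      using n_subsets[of "{1..k}" j] by (simp add: Pow_def)
  qed simp
  also have "\<dots> = (\<Sum>i\<in>{0..k}. (-1) ^ i * int (k choose i) * (int k - int i) ^ CARD('a))"
    \<comment> \<open>The summation index changes from the size \<open>j\<close> of the range to the
      number \<open>i = k - j\<close> of omitted values.\<close>
    by (rule sum.reindex_bij_witness[of _ "\<lambda>i. k - i" "\<lambda>i. k - i"])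
      (auto simp: of_nat_diff binomial_symmetric[symmetric])
  finally show ?thesis by (simp add: f_def)
qed

section \<open>Bijective level functions and linear orders\<close>

lemma range_eq_atLeastAtMost_card_iff:
  fixes h :: "'a::finite \<Rightarrow> nat"
  shows "range h = {1..CARD('a)} \<longleftrightarrow> inj h \<and> range h \<subseteq> {1..CARD('a)}"
proof
  assume h: "range h = {1..CARD('a)}"
  then have "card (range h) = CARD('a)" by simp
  then show "inj h \<and> range h \<subseteq> {1..CARD('a)}" using h by (simp add: eq_card_imp_inj_on)
next
  assume "inj h \<and> range h \<subseteq> {1..CARD('a)}"
  then show "range h = {1..CARD('a)}" by (intro card_subset_eq) (auto simp: card_image)
qed

lemma card_enumerations:
  "card {h :: 'a::finite \<Rightarrow> nat. range h = {1..CARD('a)}} = fact CARD('a)"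
proof -
  have "{h :: 'a \<Rightarrow> nat. range h = {1..CARD('a)}} =
      {h \<in> UNIV \<rightarrow>\<^sub>E {1..CARD('a)}. inj_on h UNIV}"
    by (simp only: range_eq_atLeastAtMost_card_iff image_subset_iff PiE_UNIV_domain Pi_iff
        ball_UNIV conj_commute mem_Collect_eq)
  then show ?thesis
    using card_inj_on_subset_funcset[of "UNIV :: 'a set" "{1..CARD('a)}" UNIV]
    by (simp add: fact_prod_rev)
qed

lemma ex_level_function_strict_linear_order:
  fixes r :: "'a::finite rel"
  assumes "strict_linear_order_on UNIV r"
  shows "\<exists>h. range h = {1..CARD('a)} \<and> level_order h = r"
proof -
  have trans: "trans r" and irrefl: "irrefl r" and total: "total r"
    using assms by (auto simp: strict_linear_order_on_def)
  \<comment> \<open>The position of \<open>x\<close> in the order; \<open>Suc\<close> makes the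
    least element number 1.\<close>
  define h where "h x = Suc (card {w. (w, x) \<in> r})" for x
  have mono: "h x < h y" if "(x, y) \<in> r" for x y
  proof -
    have "{w. (w, x) \<in> r} \<subset> {w. (w, y) \<in> r}"
      using that trans irrefl by (auto dest: transD simp: irrefl_def)
    then show ?thesis by (simp add: h_def psubset_card_mono)
  qed
  have "inj h"
    by (rule injI) (metis mono total less_irrefl total_on_def UNIV_I)
  moreover have "h x \<in> {1..CARD('a)}" for x
  proof -
    have "{w. (w, x) \<in> r} \<subset> UNIV" using irrefl by (auto simp: irrefl_def)
    then have "card {w. (w, x) \<in> r} < CARD('a)" by (simp add: psubset_card_mono)
    then show ?thesis by (auto simp: h_def)
  qed
  ultimately have "range h = {1..CARD('a)}"
    unfolding range_eq_atLeastAtMost_card_iff by blast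
  moreover have "level_order h = r"
  proof -
    have "(x, y) \<in> r" if "h x < h y" for x y
      using that mono total by (metis UNIV_I less_asym less_irrefl total_on_def)
    then show ?thesis using mono by auto
  qed
  ultimately show ?thesis by blast
qed

text \<open>Injectivity is the rigidity of nested level orders, and the position function gives
  surjectivity. Totality of \<open>level_order h\<close> comes from \<open>h\<close> being
  injective.\<close>

lemma bij_betw_level_order_linear_orders:
  "bij_betw level_order {h :: 'n::finite \<Rightarrow> nat. range h = {1..CARD('n)}} linear_orders"
proof (rule bij_betw_imageI)
  show "inj_on level_order {h :: 'n \<Rightarrow> nat. range h = {1..CARD('n)}}"
    by (rule inj_onI) (rule level_order_subset_imp_eq; simp)
  have "strict_linear_order_on UNIV (level_order h)" if "range h = {1..CARD('n)}" for h :: "'n \<Rightarrow> nat"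
  proof -
    have "inj h" using that range_eq_atLeastAtMost_card_iff by blast
    then show ?thesis
      by (auto simp: strict_linear_order_on_def trans_def irrefl_def total_on_def inj_def)
        (meson linorder_neqE_nat)
  qed
  then show "level_order ` {h :: 'n \<Rightarrow> nat. range h = {1..CARD('n)}} = linear_orders"
    using ex_level_function_strict_linear_order unfolding linear_orders_def by blast
qed

section \<open>Surjective level functions and ordered decompositions\<close>

definition fibres :: "nat \<Rightarrow> ('n \<Rightarrow> nat) \<Rightarrow> nat \<Rightarrow> 'n set" where
  "fibres k h = (\<lambda>p\<in>{1..k}. h -` {p})"

lemma bij_betw_fibres_ordered_decompositions:
  "bij_betw (fibres k) {h :: 'n \<Rightarrow> nat. range h = {1..k}} (ordered_decompositions k)"
proof (rule bij_betwI')
  fix g h :: "'n \<Rightarrow> nat"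
  assume "g \<in> {h. range h = {1..k}}" "h \<in> {h. range h = {1..k}}"
  then have g: "g x \<in> {1..k}" for x by blast
  show "fibres k g = fibres k h \<longleftrightarrow> g = h"
  proof
    assume eq: "fibres k g = fibres k h"
    show "g = h"
    proof
      fix x
      have "x \<in> fibres k g (g x)" using g[of x] by (simp add: fibres_def)
      then show "g x = h x" using g[of x] unfolding eq by (simp add: fibres_def)
    qed
  qed simp
next
  fix h :: "'n \<Rightarrow> nat"
  assume "h \<in> {h. range h = {1..k}}"
  then have h: "range h = {1..k}" by simp
  have "h -` {p} \<noteq> {}" if "p \<in> {1..k}" for p
    using that h by (metis image_iff vimage_singleton_eq empty_iff)
  moreover have "h x \<in> {1..k}" for x using h by blast
  ultimately show "fibres k h \<in> ordered_decompositions k"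
    by (auto simp: ordered_decompositions_def fibres_def disjoint_family_on_def)
next
  fix N :: "nat \<Rightarrow> 'n set"
  assume N: "N \<in> ordered_decompositions k"
  then have ne: "N p \<noteq> {}" if "p \<in> {1..k}" for p
    using that by (simp add: ordered_decompositions_def)
  have ex: "\<exists>p\<in>{1..k}. x \<in> N p" for x
    using N by (auto simp: ordered_decompositions_def)
  have unique: "p = q" if "p \<in> {1..k}" "q \<in> {1..k}" "x \<in> N p" "x \<in> N q" for p q x
  proof (rule ccontr)
    assume "p \<noteq> q"
    moreover have "disjoint_family_on N {1..k}" using N by (simp add: ordered_decompositions_def)
    ultimately have "N p \<inter> N q = {}" using that(1,2) by (intro disjoint_family_onD)
    then show False using that(3,4) by blast
  qed
  \<comment> \<open>The preimage of \<open>N\<close> sends each point to the index of its block,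
    which disjointness makes unique.\<close>
  obtain h where h: "h x \<in> {1..k}" "x \<in> N (h x)" for x using ex by metis
  have mem: "x \<in> N p \<longleftrightarrow> h x = p" if "p \<in> {1..k}" for x p
    using unique that h by blast
  have "fibres k h = N"
  proof
    fix p
    show "fibres k h p = N p"
    proof (cases "p \<in> {1..k}")
      case True
      then have "fibres k h p = h -` {p}" unfolding fibres_def by (rule restrict_apply')
      also have "\<dots> = N p" using mem[OF True] by blast
      finally show ?thesis .
    next
      case False
      \<comment> \<open>Outside \<open>{1..k}\<close> both families are \<open>undefined\<close>:
        \<open>N\<close> by extensionality, \<open>fibres k h\<close> by the restricted
        lambda.\<close>
      have "N \<in> extensional {1..k}"
        using N by (simp add: ordered_decompositions_def PiE_def)
      then have "N p = undefined" using False by (rule extensional_arb)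
      then show ?thesis by (simp only: fibres_def restrict_apply False if_False)
    qed
  qed
  moreover have "range h = {1..k}"
  proof
    show "range h \<subseteq> {1..k}" using h(1) by blast
    show "{1..k} \<subseteq> range h"
    proof
      fix p assume p: "p \<in> {1..k}"
      then obtain x where "x \<in> N p" using ne by blast
      then show "p \<in> range h" using mem[OF p, of x] by auto
    qed
  qed
  ultimately show "\<exists>h\<in>{h. range h = {1..k}}. N = fibres k h" by blast
qed

text \<open>Each index \<open>i\<close> lies in exactly the block numbered \<open>h i\<close>, so
  the block condition reads \<open>h i < h j\<close>. This transfers results on level functions to
  decompositions.\<close>

lemma block_semigroup_fibres:
  assumes "range h = {1..k}"
  shows "block_semigroup S k (fibres k h) = order_semigroup S (level_order h)"
proof -
  have "h i \<in> {1..k}" for i using assms by blast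
  then show ?thesis
    by (auto simp: block_semigroup_def order_semigroup_def fibres_def)
qed

section \<open>Powers and supports\<close>

text \<open>To be read as a directed graph on the indices, whose walks follow non-zero entries
  through products.\<close>

definition support_relation :: "(real^'n^'n) set \<Rightarrow> 'n rel" where
  "support_relation T = {(i, j). \<exists>A\<in>T. A $ i $ j \<noteq> 0}"

lemma set_power_Suc:
  "1 \<le> m \<Longrightarrow> set_power mul T (Suc m) = {mul a b | a b. a \<in> set_power mul T m \<and> b \<in> T}"
  by (cases m) auto

lemma set_power_nonempty:
  assumes "T \<noteq> {}" "1 \<le> m"
  shows "set_power mul T m \<noteq> {}"
  using assms(2)
  by (induction m rule: dec_induct) (use assms(1) in \<open>auto simp: set_power_Suc\<close>)

lemma set_power_subset:
  assumes "T \<subseteq> S" "\<And>a b. a \<in> S \<Longrightarrow> b \<in> S \<Longrightarrow> mul a b \<in> S" "1 \<le> m"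
  shows "set_power mul T m \<subseteq> S"
  using assms(3)
  by (induction m rule: dec_induct) (use assms(1,2) in \<open>auto simp: set_power_Suc\<close>)

section \<open>Lengths of walks in level orders\<close>

lemma relpow_subset_mono: "(R :: 'a rel) \<subseteq> R' \<Longrightarrow> R ^^ m \<subseteq> R' ^^ m"
  by (induction m) auto

lemma relpow_empty_mono: "(R :: 'a rel) ^^ m = {} \<Longrightarrow> m \<le> k \<Longrightarrow> R ^^ k = {}"
  using relpow_add[of m "k - m" R] by simp

lemma relpow_level_order: "(x, y) \<in> level_order h ^^ m \<Longrightarrow> h x + m \<le> h y"
proof (induction m arbitrary: y)
  case (Suc m)
  then obtain z where "(x, z) \<in> level_order h ^^ m" "h z < h y" by auto
  then show ?case using Suc.IH[of z] by simp
qed simp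

text \<open>Without walks of length \<open>m\<close> there is a level function \<open>g\<close> with
  values below \<open>m\<close>, strictly increasing along representatives of the \<open>k\<close>
  levels, so \<open>k \<le> m\<close>. Conversely, a walk of length \<open>m\<close> would raise
  \<open>h\<close> by at least \<open>m\<close>, but \<open>{1..k}\<close> only has room for
  \<open>k - 1\<close>.\<close>

lemma relpow_level_order_empty_iff:
  assumes h: "range h = {1..k}"
  shows "level_order h ^^ m = {} \<longleftrightarrow> k \<le> m"
proof
  assume "level_order h ^^ m = {}"
  then obtain g where g: "\<And>x. g x < m" "level_order h \<subseteq> level_order g"
    by (rule relpow_empty_imp_level_function) blast
  have "strict_mono_on {1..k} (g \<circ> inv h)"
  proof (rule strict_mono_onI)
    fix p q assume "p \<in> {1..k}" "q \<in> {1..k}" "p < q"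
    then have "(inv h p, inv h q) \<in> level_order h" using h by (simp add: f_inv_into_f)
    then show "(g \<circ> inv h) p < (g \<circ> inv h) q" using subsetD[OF g(2), of "(inv h p, inv h q)"] by simp
  qed
  then have "inj_on (g \<circ> inv h) {1..k}" by (rule strict_mono_on_imp_inj_on)
  then have "card {1..k} \<le> card {..<m}"
    by (rule card_inj_on_le) (use g(1) in auto)
  then show "k \<le> m" by simp
next
  assume "k \<le> m"
  have less: "h y < h x + m" for x y
  proof -
    have "h x \<in> {1..k}" "h y \<in> {1..k}" using h by blast+
    then show ?thesis using \<open>k \<le> m\<close> by simp
  qed
  have "(x, y) \<notin> level_order h ^^ m" for x y
    using relpow_level_order[of x y m h] less[of y x] by linarith
  then show "level_order h ^^ m = {}" by auto
qed

text \<open>The initial level function takes at most \<open>m\<close> and at most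
  \<open>CARD('a)\<close> values. The bound by the minimum covers both later uses:
  \<open>m = k\<close>, and arbitrary \<open>m\<close> with \<open>k = CARD('a)\<close>.\<close>

lemma relpow_empty_imp_level_function_onto:
  fixes R :: "'a::finite rel"
  assumes "R ^^ m = {}" and k: "min m CARD('a) \<le> k" "k \<le> CARD('a)"
  obtains h where "range h = {1..k}" "R \<subseteq> level_order h"
proof -
  from assms(1) obtain g where g: "\<And>x. g x < m" "R \<subseteq> level_order g"
    by (rule relpow_empty_imp_level_function) blast
  have "card (range g) \<le> m" using g(1) card_mono[of "{..<m}" "range g"] by auto
  moreover have "card (range g) \<le> CARD('a)" by (rule card_image_le) simp
  ultimately have "card (range g) \<le> k" using k(1) by linarith
  from level_order_refine[OF this k(2)] show thesis using that g(2) by blast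
qed

text \<open>A cofinal antichain inside \<open>F\<close> is its set of maximal elements.\<close>

lemma maximal_elements_eqI:
  assumes "G \<subseteq> F" "\<And>T. T \<in> F \<Longrightarrow> \<exists>U\<in>G. T \<subseteq> U"
    and "\<And>T U. T \<in> G \<Longrightarrow> U \<in> G \<Longrightarrow> T \<subseteq> U \<Longrightarrow> T = U"
  shows "maximal_elements F = G"
proof
  show "maximal_elements F \<subseteq> G"
  proof
    fix T assume T: "T \<in> maximal_elements F"
    then obtain U where U: "U \<in> G" "T \<subseteq> U" using assms(2)[of T] unfolding maximal_elements_def by blast
    have "U = T" using T U assms(1) unfolding maximal_elements_def by blast
    then show "T \<in> G" using \<open>U \<in> G\<close> by simp
  qed
  show "G \<subseteq> maximal_elements F"
  proof
    fix T assume T: "T \<in> G"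
    have "T' = T" if T': "T' \<in> F" "T \<subseteq> T'" for T'
    proof -
      obtain U where U: "U \<in> G" "T' \<subseteq> U" using assms(2)[OF T'(1)] by blast
      then show ?thesis using assms(3)[OF T U(1)] T'(2) by blast
    qed
    then show "T \<in> maximal_elements F" using T assms(1) unfolding maximal_elements_def by blast
  qed
qed

section \<open>Permuting rows and columns\<close>

text \<open>Conjugation by a permutation matrix in entrywise form, free of matrix inverses.\<close>

definition permute_mat :: "('n \<Rightarrow> 'n) \<Rightarrow> real^'n^'n \<Rightarrow> real^'n^'n" where
  "permute_mat \<sigma> A = (\<chi> i j. A $ \<sigma> i $ \<sigma> j)"

lemma permute_mat_nth [simp]: "permute_mat \<sigma> A $ i $ j = A $ \<sigma> i $ \<sigma> j"
  by (simp add: permute_mat_def)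

lemma permute_mat_mult:
  fixes \<sigma> :: "'n::finite \<Rightarrow> 'n"
  assumes "bij \<sigma>"
  shows "permute_mat \<sigma> (A ** B) = permute_mat \<sigma> A ** permute_mat \<sigma> B"
proof -
  have "(\<Sum>k\<in>UNIV. A $ \<sigma> i $ k * B $ k $ \<sigma> j) = (\<Sum>k\<in>UNIV. A $ \<sigma> i $ \<sigma> k * B $ \<sigma> k $ \<sigma> j)" for i j
    using sum.reindex_bij_betw[OF assms, of "\<lambda>k. A $ \<sigma> i $ k * B $ k $ \<sigma> j"] by simp
  then show ?thesis by (simp add: vec_eq_iff matrix_matrix_mult_def)
qed

lemma inj_permute_mat: "surj \<sigma> \<Longrightarrow> inj (permute_mat \<sigma>)"
  by (rule injI) (metis permute_mat_nth surjD vec_eq_iff)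

lemma mult_perm_mat_nth:
  fixes \<pi> :: "'n::finite \<Rightarrow> 'n"
  assumes "bij \<pi>"
  shows "(A ** perm_mat \<pi>) $ i $ j = A $ i $ inv \<pi> j"
proof -
  have "j = \<pi> k \<longleftrightarrow> k = inv \<pi> j" for k
    using assms by (metis bij_inv_eq_iff)
  then show ?thesis by (simp add: matrix_matrix_mult_def perm_mat_def if_distrib cong: if_cong)
qed

lemma perm_mat_mult_nth:
  fixes \<pi> :: "'n::finite \<Rightarrow> 'n"
  shows "(perm_mat \<pi> ** A) $ i $ j = A $ \<pi> i $ j"
  by (simp add: matrix_matrix_mult_def perm_mat_def if_distrib[of "\<lambda>x. x * _"] cong: if_cong)

lemma perm_mat_inverse:
  fixes \<pi> :: "'n::finite \<Rightarrow> 'n"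
  assumes "bij \<pi>"
  shows "perm_mat \<pi> ** perm_mat (inv \<pi>) = mat 1" "perm_mat (inv \<pi>) ** perm_mat \<pi> = mat 1"
proof -
  have "inv \<pi> (\<pi> i) = i" "\<pi> (inv \<pi> i) = i" for i
    using assms by (simp_all add: bij_is_inj bij_is_surj surj_f_inv_f)
  then show "perm_mat \<pi> ** perm_mat (inv \<pi>) = mat 1" "perm_mat (inv \<pi>) ** perm_mat \<pi> = mat 1"
    by (auto simp: vec_eq_iff perm_mat_mult_nth mat_def) (auto simp: perm_mat_def)
qed

lemma invertible_perm_mat:
  fixes \<pi> :: "'n::finite \<Rightarrow> 'n"
  shows "bij \<pi> \<Longrightarrow> invertible (perm_mat \<pi>)"
  using perm_mat_inverse unfolding invertible_def by blast

text \<open>\<open>matrix_inv\<close> is defined by choice among two-sided inverses; their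
  uniqueness determines its value.\<close>

lemma matrix_inv_unique:
  fixes A :: "real^'n^'n"
  assumes "A ** B = mat 1" "B ** A = mat 1"
  shows "matrix_inv A = B"
  unfolding matrix_inv_def
proof (rule some_equality)
  fix C assume "A ** C = mat 1 \<and> C ** A = mat 1"
  then have "C = C ** (A ** B)" "B = (C ** A) ** B" using assms by simp_all
  then show "C = B" by (simp add: matrix_mul_assoc)
qed (use assms in simp)

text \<open>The left factor is \<open>perm_mat (inv \<pi>)\<close> and moves rows by
  \<open>inv \<pi>\<close>; the right factor \<open>perm_mat \<pi>\<close> reads columns through
  \<open>inv \<pi>\<close> as well.\<close>

lemma conjugate_perm_mat:
  fixes \<pi> :: "'n::finite \<Rightarrow> 'n"
  assumes "bij \<pi>"
  shows "matrix_inv (perm_mat \<pi>) ** A ** perm_mat \<pi> = permute_mat (inv \<pi>) A"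
proof -
  have "matrix_inv (perm_mat \<pi>) = perm_mat (inv \<pi>)"
    using perm_mat_inverse[OF assms] by (rule matrix_inv_unique)
  show ?thesis
    unfolding \<open>matrix_inv (perm_mat \<pi>) = perm_mat (inv \<pi>)\<close>
    by (simp add: vec_eq_iff perm_mat_mult_nth mult_perm_mat_nth[OF assms])
qed

section \<open>Matrix semigroups without cancellation\<close>

text \<open>The common features of the three semigroups: \<open>unit_mem\<close> lets every relation
  occur as a support, \<open>permute_mem\<close> allows conjugation, and \<open>mult_nonzero\<close>
  excludes cancellation.\<close>

locale matrix_semigroup_no_cancel =
  fixes S :: "(real^'n::finite^'n) set"
  assumes zero_mem: "0 \<in> S"
    and mult_mem: "A \<in> S \<Longrightarrow> B \<in> S \<Longrightarrow> A ** B \<in> S"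
    and unit_mem: "(\<chi> k l. if k = i \<and> l = j then 1 else 0) \<in> S"
    and permute_mem: "bij \<sigma> \<Longrightarrow> A \<in> S \<Longrightarrow> permute_mat \<sigma> A \<in> S"
    and mult_nonzero: "A \<in> S \<Longrightarrow> B \<in> S \<Longrightarrow> A $ i $ k \<noteq> 0 \<Longrightarrow> B $ k $ j \<noteq> 0 \<Longrightarrow> (A ** B) $ i $ j \<noteq> 0"

text \<open>The converse of \<open>mult_nonzero\<close>, valid for all real matrices: a non-zero sum
  has a non-zero summand.\<close>

lemma mult_nonzeroD:
  fixes A B :: "real^'n::finite^'n"
  assumes "(A ** B) $ i $ j \<noteq> 0"
  obtains k where "A $ i $ k \<noteq> 0" "B $ k $ j \<noteq> 0"
proof -
  have "(\<Sum>k\<in>UNIV. A $ i $ k * B $ k $ j) \<noteq> 0"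
    using assms by (simp add: matrix_matrix_mult_def)
  then obtain k where "A $ i $ k * B $ k $ j \<noteq> 0"
    by (rule sum.not_neutral_contains_not_neutral)
  then show thesis using that[of k] by simp
qed

context matrix_semigroup_no_cancel
begin

section \<open>Nilpotency as absence of long walks\<close>

abbreviation "mat_power \<equiv> set_power ((**) :: real^'n^'n \<Rightarrow> real^'n^'n \<Rightarrow> real^'n^'n)"

lemma support_relation_power:
  assumes "T \<subseteq> S" "1 \<le> m"
  shows "support_relation (mat_power T m) = support_relation T ^^ m"
  using assms(2)
proof (induction m rule: dec_induct)
  case base
  then show ?case by simp
next
  case (step m)
  \<comment> \<open>Absence of cancellation is known only for members of \<open>S\<close>, so the
    powers must stay inside \<open>S\<close>.\<close>
  have sub: "mat_power T m \<subseteq> S" using set_power_subset assms(1) mult_mem step.hyps by blast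
  have "support_relation (mat_power T (Suc m)) = support_relation (mat_power T m) O support_relation T"
  proof (intro subset_antisym subrelI)
    fix i j assume "(i, j) \<in> support_relation (mat_power T (Suc m))"
    then show "(i, j) \<in> support_relation (mat_power T m) O support_relation T"
      using step.hyps by (fastforce simp: support_relation_def set_power_Suc elim: mult_nonzeroD)
  next
    fix i j assume "(i, j) \<in> support_relation (mat_power T m) O support_relation T"
    then obtain k A B where "A \<in> mat_power T m" "B \<in> T" "A $ i $ k \<noteq> 0" "B $ k $ j \<noteq> 0"
      by (auto simp: support_relation_def)
    moreover from this have "(A ** B) $ i $ j \<noteq> 0"
      using mult_nonzero sub assms(1) by blast
    ultimately show "(i, j) \<in> support_relation (mat_power T (Suc m))"
      using step.hyps by (auto simp: support_relation_def set_power_Suc)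
  qed
  then show ?case using step.IH by simp
qed

text \<open>An empty support means that only the zero matrix can occur, and it does occur because
  the power is non-empty.\<close>

lemma power_eq_zero_iff:
  assumes "T \<subseteq> S" "T \<noteq> {}" "1 \<le> m"
  shows "mat_power T m = {0} \<longleftrightarrow> support_relation T ^^ m = {}"
proof -
  have "support_relation U = {} \<longleftrightarrow> U \<subseteq> {0}" for U :: "(real^'n^'n) set"
    by (auto simp: support_relation_def vec_eq_iff)
  then show ?thesis
    using set_power_nonempty[OF assms(2,3), of "(**)"]
    by (simp add: support_relation_power[OF assms(1,3), symmetric] subset_singleton_iff)
qed

text \<open>Once there is no walk of length \<open>c\<close>, there is none of any greater length;
  so a class at most \<open>m\<close> is detected at the single exponent \<open>m\<close>.\<close>

lemma Nil_upto_iff: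
  assumes "1 \<le> m"
  shows "T \<in> Nil_upto (**) 0 S m \<longleftrightarrow> subsemigroup_of (**) S T \<and> support_relation T ^^ m = {}"
proof (cases "subsemigroup_of (**) S T")
  case True
  then have T: "T \<subseteq> S" "T \<noteq> {}" by (auto simp: subsemigroup_of_def)
  show ?thesis
  proof
    assume nil: "T \<in> Nil_upto (**) 0 S m"
    define c where "c = nilpotency_class (**) 0 T"
    have "c \<le> m" using nil by (simp add: Nil_upto_def c_def)
    have "\<exists>k. 1 \<le> k \<and> mat_power T k = {0}"
      using nil by (auto simp: Nil_upto_def nilpotent_set_def)
    from LeastI_ex[OF this] have "1 \<le> c" "mat_power T c = {0}"
      by (simp_all add: c_def nilpotency_class_def)
    then show "subsemigroup_of (**) S T \<and> support_relation T ^^ m = {}"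
      using True power_eq_zero_iff[OF T, of c] relpow_empty_mono[OF _ \<open>c \<le> m\<close>] by simp
  next
    assume "subsemigroup_of (**) S T \<and> support_relation T ^^ m = {}"
    then have "1 \<le> m \<and> mat_power T m = {0}" using power_eq_zero_iff[OF T] assms by simp
    then show "T \<in> Nil_upto (**) 0 S m"
      using True unfolding Nil_upto_def nilpotent_set_def nilpotency_class_def
      by (auto intro: Least_le)
  qed
qed (simp add: Nil_upto_def)

text \<open>The matrix units at the positions in \<open>r\<close> realise every pair.\<close>

lemma support_relation_order_semigroup: "support_relation (order_semigroup S r) = r"
proof
  show "r \<subseteq> support_relation (order_semigroup S r)"
  proof (rule subrelI)
    fix i j assume "(i, j) \<in> r"
    then have "(\<chi> k l. if k = i \<and> l = j then 1 else 0) \<in> order_semigroup S r"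
      by (simp add: order_semigroup_def unit_mem)
    then show "(i, j) \<in> support_relation (order_semigroup S r)"
      unfolding support_relation_def by force
  qed
qed (auto simp: support_relation_def order_semigroup_def)

text \<open>A Galois connection between subsets of \<open>S\<close> and relations on the
  indices.\<close>

lemma subset_order_semigroup_iff:
  "T \<subseteq> S \<Longrightarrow> T \<subseteq> order_semigroup S r \<longleftrightarrow> support_relation T \<subseteq> r"
  by (auto simp: order_semigroup_def support_relation_def)

lemma order_semigroup_subset_iff:
  "order_semigroup S r \<subseteq> order_semigroup S r' \<longleftrightarrow> r \<subseteq> r'"
  using subset_order_semigroup_iff[of "order_semigroup S r" r'] support_relation_order_semigroup
  by (auto simp: order_semigroup_def)

section \<open>Level orders and maximal subsemigroups of bounded class\<close>

lemma subsemigroup_order_semigroup: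
  assumes "trans r"
  shows "subsemigroup_of (**) S (order_semigroup S r)"
proof -
  have "0 \<in> order_semigroup S r" by (simp add: order_semigroup_def zero_mem)
  moreover have "A ** B \<in> order_semigroup S r"
    if AB: "A \<in> order_semigroup S r" "B \<in> order_semigroup S r" for A B
  proof -
    have "(i, j) \<in> r" if nz: "(A ** B) $ i $ j \<noteq> 0" for i j
    proof -
      obtain k where "A $ i $ k \<noteq> 0" "B $ k $ j \<noteq> 0" using nz by (rule mult_nonzeroD)
      then have "(i, k) \<in> r" "(k, j) \<in> r" using AB by (simp_all add: order_semigroup_def)
      then show ?thesis using assms by (blast dest: transD)
    qed
    then show ?thesis using AB by (simp add: order_semigroup_def mult_mem)
  qed
  moreover have "order_semigroup S r \<subseteq> S" by (auto simp: order_semigroup_def)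
  ultimately show ?thesis unfolding subsemigroup_of_def by blast
qed

lemma level_semigroup_mem_Nil_upto_iff:
  assumes "range h = {1..k}" "1 \<le> m"
  shows "order_semigroup S (level_order h) \<in> Nil_upto (**) 0 S m \<longleftrightarrow> k \<le> m"
proof -
  have "trans (level_order h)" by (auto simp: trans_def)
  then show ?thesis
    using assms by (simp add: Nil_upto_iff subsemigroup_order_semigroup
        support_relation_order_semigroup relpow_level_order_empty_iff)
qed

text \<open>The semigroups of level functions onto \<open>{1..k}\<close> are cofinal in
  \<open>Nil_upto\<close>, since every support without walks of length \<open>k\<close> fits into
  such a level order, and rigidity makes them an antichain.\<close>

lemma bij_betw_max_nilpotent_class:
  assumes k: "1 \<le> k" "k \<le> CARD('n)"
  shows "bij_betw (\<lambda>h. order_semigroup S (level_order h)) {h. range h = {1..k}}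
    (max_nilpotent_class (**) 0 S k)"
proof (rule bij_betw_imageI)
  have eq: "g = h" if "range g = {1..k}" "range h = {1..k}"
    "order_semigroup S (level_order g) \<subseteq> order_semigroup S (level_order h)" for g h
    using that level_order_subset_imp_eq order_semigroup_subset_iff by metis
  then show "inj_on (\<lambda>h. order_semigroup S (level_order h)) {h. range h = {1..k}}"
    by (auto intro: inj_onI)
  show "(\<lambda>h. order_semigroup S (level_order h)) ` {h. range h = {1..k}} =
      max_nilpotent_class (**) 0 S k"
    unfolding max_nilpotent_class_def
  proof (rule maximal_elements_eqI[symmetric])
    show "(\<lambda>h. order_semigroup S (level_order h)) ` {h. range h = {1..k}} \<subseteq> Nil_upto (**) 0 S k"
      using level_semigroup_mem_Nil_upto_iff k(1) by auto
  next
    fix T assume "T \<in> Nil_upto (**) 0 S k"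
    then have T: "T \<subseteq> S" "support_relation T ^^ k = {}"
      using Nil_upto_iff[OF k(1)] by (auto simp: subsemigroup_of_def)
    from T(2) obtain h where "range h = {1..k}" "support_relation T \<subseteq> level_order h"
      by (rule relpow_empty_imp_level_function_onto) (use k in auto)
    then show "\<exists>U\<in>(\<lambda>h. order_semigroup S (level_order h)) ` {h. range h = {1..k}}. T \<subseteq> U"
      using subset_order_semigroup_iff[OF T(1)] by auto
  qed (use eq in blast)
qed

text \<open>Nilpotency of any class puts the support into a level order with \<open>CARD('n)\<close>
  levels, which has no walk of that length. The unbounded problem thus becomes the case
  \<open>k = CARD('n)\<close>.\<close>

lemma Nil_all_eq: "Nil_all (**) 0 S = Nil_upto (**) 0 S CARD('n)"
proof
  have n: "1 \<le> CARD('n)" by (simp add: Suc_le_eq)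
  then show "Nil_upto (**) 0 S CARD('n) \<subseteq> Nil_all (**) 0 S" unfolding Nil_all_def by blast
  show "Nil_all (**) 0 S \<subseteq> Nil_upto (**) 0 S CARD('n)"
  proof
    fix T assume "T \<in> Nil_all (**) 0 S"
    then obtain m where T: "subsemigroup_of (**) S T" "support_relation T ^^ m = {}"
      using Nil_upto_iff by (auto simp: Nil_all_def)
    from T(2) min.cobounded2 order_refl
    obtain h where h: "range h = {1..CARD('n)}" "support_relation T \<subseteq> level_order h"
      by (rule relpow_empty_imp_level_function_onto)
    then have "support_relation T ^^ CARD('n) = {}"
      using relpow_subset_mono[OF h(2)] relpow_level_order_empty_iff[OF h(1)] by blast
    then show "T \<in> Nil_upto (**) 0 S CARD('n)" using T(1) n Nil_upto_iff by blast
  qed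
qed

section \<open>Maximal nilpotent subsemigroups, linear orders and conjugation\<close>

lemma bij_betw_max_nilpotent:
  "bij_betw (\<lambda>h. order_semigroup S (level_order h)) {h. range h = {1..CARD('n)}}
    (max_nilpotent (**) 0 S)"
  using bij_betw_max_nilpotent_class[of "CARD('n)"]
  by (simp add: max_nilpotent_def max_nilpotent_class_def Nil_all_eq Suc_le_eq)

lemma max_nilpotentE:
  assumes "T \<in> max_nilpotent (**) 0 S"
  obtains h where "range h = {1..CARD('n)}" "T = order_semigroup S (level_order h)"
  using assms bij_betw_imp_surj_on[OF bij_betw_max_nilpotent] by blast

lemma card_max_nilpotent: "card (max_nilpotent (**) 0 S) = fact CARD('n)"
  using bij_betw_same_card[OF bij_betw_max_nilpotent] card_enumerations by metis

lemma bij_betw_order_semigroup: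
  "bij_betw (order_semigroup S) linear_orders (max_nilpotent (**) 0 S)"
  using bij_betw_comp_iff[OF bij_betw_level_order_linear_orders, of "order_semigroup S"]
    bij_betw_max_nilpotent by (simp add: comp_def)

text \<open>\<open>T\<close> lies in \<open>Nil_upto\<close> for exactly the bounds
  \<open>m \<ge> CARD('n)\<close>; testing \<open>m = CARD('n)\<close> and \<open>m = c\<close>
  bounds the class \<open>c\<close> from both sides.\<close>

lemma nilpotency_class_max_nilpotent:
  assumes "T \<in> max_nilpotent (**) 0 S"
  shows "nilpotency_class (**) 0 T = CARD('n)"
proof -
  obtain h where h: "range h = {1..CARD('n)}" "T = order_semigroup S (level_order h)"
    using assms by (rule max_nilpotentE)
  have nil: "T \<in> Nil_upto (**) 0 S m \<longleftrightarrow> CARD('n) \<le> m" if "1 \<le> m" for m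
    using level_semigroup_mem_Nil_upto_iff[OF h(1) that] h(2) by simp
  define c where "c = nilpotency_class (**) 0 T"
  have T: "T \<in> Nil_upto (**) 0 S CARD('n)" using nil[of "CARD('n)"] by (simp add: Suc_le_eq)
  then have "\<exists>k. 1 \<le> k \<and> mat_power T k = {0}"
    by (auto simp: Nil_upto_def nilpotent_set_def)
  from LeastI_ex[OF this] have "1 \<le> c" by (simp add: c_def nilpotency_class_def)
  moreover have "T \<in> Nil_upto (**) 0 S c" "c \<le> CARD('n)"
    using T by (simp_all add: Nil_upto_def c_def)
  ultimately show ?thesis using nil[of c] by (simp add: c_def)
qed

lemma permute_order_semigroup:
  assumes "bij \<sigma>" and r: "\<And>i j. (i, j) \<in> r' \<longleftrightarrow> (\<sigma> i, \<sigma> j) \<in> r"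
  shows "permute_mat \<sigma> ` order_semigroup S r = order_semigroup S r'"
proof
  show "permute_mat \<sigma> ` order_semigroup S r \<subseteq> order_semigroup S r'"
    using permute_mem[OF \<open>bij \<sigma>\<close>] r by (auto simp: order_semigroup_def)
  show "order_semigroup S r' \<subseteq> permute_mat \<sigma> ` order_semigroup S r"
  proof
    fix A assume A: "A \<in> order_semigroup S r'"
    have inv: "\<sigma> (inv \<sigma> i) = i" "inv \<sigma> (\<sigma> i) = i" for i
      using \<open>bij \<sigma>\<close> by (simp_all add: bij_is_inj bij_is_surj surj_f_inv_f)
    have "permute_mat (inv \<sigma>) A \<in> order_semigroup S r"
      using A permute_mem[OF bij_imp_bij_inv[OF \<open>bij \<sigma>\<close>]]
      by (auto simp: order_semigroup_def r) (metis inv(1))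
    moreover have "A = permute_mat \<sigma> (permute_mat (inv \<sigma>) A)"
      by (simp add: vec_eq_iff inv)
    ultimately show "A \<in> permute_mat \<sigma> ` order_semigroup S r" by blast
  qed
qed

lemma max_nilpotent_isomorphic:
  assumes "T \<in> max_nilpotent (**) 0 S" "U \<in> max_nilpotent (**) 0 S"
  shows "semigroup_isomorphic (**) T U"
proof -
  obtain g where g: "range g = {1..CARD('n)}" "T = order_semigroup S (level_order g)"
    using assms(1) by (rule max_nilpotentE)
  obtain h where h: "range h = {1..CARD('n)}" "U = order_semigroup S (level_order h)"
    using assms(2) by (rule max_nilpotentE)
  \<comment> \<open>\<open>\<sigma>\<close> sends the point at position \<open>p\<close> of the
    second order to the point at position \<open>p\<close> of the first.\<close>
  define \<sigma> where "\<sigma> = inv g \<circ> h"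
  have g_\<sigma>: "g (\<sigma> x) = h x" for x
    using g(1) h(1) by (metis \<sigma>_def comp_apply f_inv_into_f rangeI)
  have "inj h" using h(1) range_eq_atLeastAtMost_card_iff by blast
  then have "inj \<sigma>" by (metis g_\<sigma> inj_def)
  then have "bij \<sigma>" by (simp add: bij_def finite_UNIV_inj_surj)
  have "permute_mat \<sigma> ` T = U"
    unfolding g h by (rule permute_order_semigroup) (simp_all add: \<open>bij \<sigma>\<close> g_\<sigma>)
  then have "bij_betw (permute_mat \<sigma>) T U"
    using inj_permute_mat[OF bij_is_surj[OF \<open>bij \<sigma>\<close>]]
    by (auto simp: bij_betw_def intro: inj_on_subset)
  then show ?thesis
    unfolding semigroup_isomorphic_def using permute_mat_mult[OF \<open>bij \<sigma>\<close>] by blast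
qed

text \<open>Conjugation by \<open>perm_mat \<pi>\<close> reads entries through
  \<open>inv \<pi>\<close>, which takes \<open>j s\<close> back to \<open>i s\<close> and so carries
  \<open>r2\<close> to \<open>r1\<close>.\<close>

lemma order_semigroup_conjugate:
  assumes i: "enumerates i r1" and j: "enumerates j r2"
    and \<pi>: "\<pi> permutes UNIV" "\<forall>s\<in>{1..CARD('n)}. \<pi> (i s) = j s"
  shows "order_semigroup S r2 =
    (\<lambda>A. matrix_inv (perm_mat \<pi>) ** A ** perm_mat \<pi>) ` order_semigroup S r1"
proof -
  have "bij \<pi>" using \<pi>(1) by (simp add: permutes_bij)
  have "(k, l) \<in> r2 \<longleftrightarrow> (inv \<pi> k, inv \<pi> l) \<in> r1" for k l
  proof -
    have "j ` {1..CARD('n)} = UNIV" using j by (simp add: enumerates_def bij_betw_def)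
    then obtain s t where st: "s \<in> {1..CARD('n)}" "t \<in> {1..CARD('n)}" "k = j s" "l = j t"
      by blast
    then have "inv \<pi> k = i s" "inv \<pi> l = i t"
      using \<pi>(2) \<open>bij \<pi>\<close> by (metis bij_inv_eq_iff)+
    then show ?thesis using i j st unfolding enumerates_def by simp
  qed
  from permute_order_semigroup[OF bij_imp_bij_inv[OF \<open>bij \<pi>\<close>] this] show ?thesis
    by (simp add: conjugate_perm_mat[OF \<open>bij \<pi>\<close>])
qed

section \<open>Ordered decompositions and the count for class \<open>k\<close>\<close>

lemma bij_betw_block_semigroup:
  assumes "1 \<le> k" "k \<le> CARD('n)"
  shows "bij_betw (block_semigroup S k) (ordered_decompositions k)
    (max_nilpotent_class (**) 0 S k)"
proof -
  have "bij_betw (block_semigroup S k \<circ> fibres k) {h. range h = {1..k}}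
      (max_nilpotent_class (**) 0 S k)"
    using bij_betw_max_nilpotent_class[OF assms]
    by (rule bij_betw_cong[THEN iffD1, rotated]) (simp add: block_semigroup_fibres)
  then show ?thesis
    using bij_betw_comp_iff[OF bij_betw_fibres_ordered_decompositions] by blast
qed

lemma block_semigroup_mem_max_nilpotent_class:
  assumes "1 \<le> k" "N \<in> ordered_decompositions k"
  shows "block_semigroup S k N \<in> max_nilpotent_class (**) 0 S k"
proof -
  have "N \<in> fibres k ` {h. range h = {1..k}}"
    using assms(2) bij_betw_imp_surj_on[OF bij_betw_fibres_ordered_decompositions] by metis
  then obtain h :: "'n \<Rightarrow> nat" where "range h = {1..k}" by blast
  \<comment> \<open>The existence of a decomposition into \<open>k\<close> non-empty blocks already
    forces this bound.\<close>
  then have "k \<le> CARD('n)" using card_image_le[of "UNIV :: 'n set" h] by simp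
  then show ?thesis using bij_betw_block_semigroup[OF assms(1)] assms(2) by (blast dest: bij_betwE)
qed

lemma card_max_nilpotent_class:
  assumes "1 \<le> k" "k \<le> CARD('n)"
  shows "int (card (max_nilpotent_class (**) 0 S k)) =
    (\<Sum>i=0..k-1. (-1) ^ i * int (k choose i) * (int k - int i) ^ CARD('n))"
proof -
  \<comment> \<open>The summand at \<open>i = k\<close> contains \<open>0 ^ CARD('n)\<close>, which
    is 0 because the exponent is positive.\<close>
  have "{0..k} = insert k {0..k-1}" "k \<notin> {0..k-1}" using assms(1) by auto
  then have "(\<Sum>i=0..k. (-1) ^ i * int (k choose i) * (int k - int i) ^ CARD('n)) =
      (\<Sum>i=0..k-1. (-1) ^ i * int (k choose i) * (int k - int i) ^ CARD('n))"
    by (simp add: zero_power)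
  then show ?thesis
    using bij_betw_same_card[OF bij_betw_max_nilpotent_class[OF assms]] card_functions_onto[where 'a='n, of k]
    by simp
qed

end

section \<open>The three semigroups\<close>

text \<open>Supports of these matrices are partial injections, and partial injections
  compose.\<close>

lemma M0_mat_mult:
  fixes A B :: "real^'n::finite^'n"
  assumes A: "A \<in> M0_mat" and B: "B \<in> M0_mat"
  shows "A ** B \<in> M0_mat"
proof -
  have "j = j'" if "(A ** B) $ i $ j \<noteq> 0" "(A ** B) $ i $ j' \<noteq> 0" for i j j'
    using that A B unfolding M0_mat_def by (elim mult_nonzeroD) blast
  moreover have "i = i'" if "(A ** B) $ i $ j \<noteq> 0" "(A ** B) $ i' $ j \<noteq> 0" for i i' j
    using that A B unfolding M0_mat_def by (elim mult_nonzeroD) blast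
  ultimately show ?thesis unfolding M0_mat_def by blast
qed

text \<open>Row \<open>i\<close> of \<open>A\<close> has its only non-zero entry at
  \<open>k\<close>, so the sum for the product entry has a single non-zero term.\<close>

lemma M0_mat_mult_nonzero:
  fixes A B :: "real^'n::finite^'n"
  assumes A: "A \<in> M0_mat" and nz: "A $ i $ k \<noteq> 0" "B $ k $ j \<noteq> 0"
  shows "(A ** B) $ i $ j \<noteq> 0"
proof -
  have "A $ i $ l = 0" if "l \<noteq> k" for l using A nz that by (auto simp: M0_mat_def)
  then have "(\<Sum>l\<in>UNIV. A $ i $ l * B $ l $ j) = (\<Sum>l\<in>{k}. A $ i $ l * B $ l $ j)"
    by (intro sum.mono_neutral_right) auto
  then show ?thesis using nz by (simp add: matrix_matrix_mult_def)
qed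

lemma permute_mat_M0: "bij \<sigma> \<Longrightarrow> A \<in> M0_mat \<Longrightarrow> permute_mat \<sigma> A \<in> M0_mat"
  unfolding M0_mat_def mem_Collect_eq permute_mat_nth by (metis bij_is_inj inj_eq)

lemma Omega_mat_mult:
  fixes A B :: "real^'n::finite^'n"
  shows "A \<in> Omega_mat \<Longrightarrow> B \<in> Omega_mat \<Longrightarrow> A ** B \<in> Omega_mat"
  by (auto simp: Omega_mat_def matrix_matrix_mult_def intro: sum_nonneg)

text \<open>A sum of non-negative terms vanishes only if every term does.\<close>

lemma Omega_mat_mult_nonzero:
  fixes A B :: "real^'n::finite^'n"
  assumes "A \<in> Omega_mat" "B \<in> Omega_mat" "A $ i $ k \<noteq> 0" "B $ k $ j \<noteq> 0"
  shows "(A ** B) $ i $ j \<noteq> 0"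
  using assms
  by (auto simp: Omega_mat_def matrix_matrix_mult_def sum_nonneg_eq_0_iff)

lemma permute_mat_Omega: "A \<in> Omega_mat \<Longrightarrow> permute_mat \<sigma> A \<in> Omega_mat"
  by (simp add: Omega_mat_def)

lemma matrix_semigroup_no_cancel_M0: "matrix_semigroup_no_cancel M0_mat"
proof (rule matrix_semigroup_no_cancel.intro)
  show "(0 :: real^'n^'n) \<in> M0_mat" by (simp add: M0_mat_def)
  show "(\<chi> k l. if k = i \<and> l = j then 1 else 0) \<in> M0_mat" for i j by (simp add: M0_mat_def)
qed (rule M0_mat_mult M0_mat_mult_nonzero permute_mat_M0; assumption)+

lemma matrix_semigroup_no_cancel_Omega: "matrix_semigroup_no_cancel Omega_mat"
proof (rule matrix_semigroup_no_cancel.intro)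
  show "(0 :: real^'n^'n) \<in> Omega_mat" by (simp add: Omega_mat_def)
  show "(\<chi> k l. if k = i \<and> l = j then 1 else 0) \<in> Omega_mat" for i j by (simp add: Omega_mat_def)
qed (rule Omega_mat_mult Omega_mat_mult_nonzero permute_mat_Omega; assumption)+

text \<open>Every locale condition passes to the intersection of two such semigroups.\<close>

lemma matrix_semigroup_no_cancel_M0_nonneg: "matrix_semigroup_no_cancel M0_nonneg_mat"
proof -
  interpret M0: matrix_semigroup_no_cancel M0_mat by (rule matrix_semigroup_no_cancel_M0)
  interpret Omega: matrix_semigroup_no_cancel Omega_mat by (rule matrix_semigroup_no_cancel_Omega)
  show ?thesis
    unfolding M0_nonneg_mat_def
    by unfold_locales
      (simp_all only: Int_iff M0.zero_mem M0.mult_mem M0.unit_mem M0.permute_mem M0.mult_nonzero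
        Omega.zero_mem Omega.mult_mem Omega.unit_mem Omega.permute_mem simp_thms not_False_eq_True)
qed

theorem theorem3p1:
  fixes S :: "(real^'n::finite^'n) set"
  assumes "S = M0_mat \<or> S = M0_nonneg_mat \<or> S = Omega_mat"
  shows
    "(card (max_nilpotent matrix_matrix_mult 0 S) = fact CARD('n)
      \<and> (\<forall>T \<in> max_nilpotent matrix_matrix_mult 0 S.
           nilpotency_class matrix_matrix_mult 0 T = CARD('n)))
     \<and> bij_betw (order_semigroup S) linear_orders (max_nilpotent matrix_matrix_mult 0 S)
     \<and> (\<forall>r1\<in>linear_orders. \<forall>r2\<in>linear_orders. \<forall>i j \<pi>.
          enumerates i r1 \<and> enumerates j r2 \<and> \<pi> permutes UNIV \<and>
          (\<forall>s\<in>{1..CARD('n)}. \<pi> (i s) = j s) \<longrightarrow>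
          invertible (perm_mat \<pi> :: real^'n^'n) \<and>
          order_semigroup S r2 =
            (\<lambda>A. matrix_inv (perm_mat \<pi>) ** A ** perm_mat \<pi>) ` order_semigroup S r1)
     \<and> (\<forall>T1 \<in> max_nilpotent matrix_matrix_mult 0 S.
          \<forall>T2 \<in> max_nilpotent matrix_matrix_mult 0 S.
            semigroup_isomorphic matrix_matrix_mult T1 T2)
     \<and> (\<forall>k. 1 \<le> k \<and> k < CARD('n) \<longrightarrow>
          int (card (max_nilpotent_class matrix_matrix_mult 0 S k)) =
            (\<Sum>i=0..k-1. (-1) ^ i * int (k choose i) * (int k - int i) ^ CARD('n))
          \<and> bij_betw (block_semigroup S k) (ordered_decompositions k)
               (max_nilpotent_class matrix_matrix_mult 0 S k))
     \<and> (\<forall>k\<ge>1. \<forall>N\<in>ordered_decompositions k.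
          block_semigroup S k N \<in> max_nilpotent_class matrix_matrix_mult 0 S k)"
proof -
  have "matrix_semigroup_no_cancel S"
    using assms matrix_semigroup_no_cancel_M0 matrix_semigroup_no_cancel_M0_nonneg
      matrix_semigroup_no_cancel_Omega by blast
  then interpret matrix_semigroup_no_cancel S .
  show ?thesis
  proof (intro conjI ballI allI impI; (elim conjE)?)
    show "card (max_nilpotent (**) 0 S) = fact CARD('n)" by (rule card_max_nilpotent)
    show "bij_betw (order_semigroup S) linear_orders (max_nilpotent (**) 0 S)"
      by (rule bij_betw_order_semigroup)
  next
    fix T assume "T \<in> max_nilpotent (**) 0 S"
    then show "nilpotency_class (**) 0 T = CARD('n)" by (rule nilpotency_class_max_nilpotent)
  next
    fix \<pi> :: "'n \<Rightarrow> 'n" assume "\<pi> permutes UNIV"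
    then show "invertible (perm_mat \<pi> :: real^'n^'n)"
      by (intro invertible_perm_mat permutes_bij)
  next
    fix r1 r2 :: "'n rel" and i j \<pi>
    assume "enumerates i r1" "enumerates j r2" "\<pi> permutes UNIV"
      "\<forall>s\<in>{1..CARD('n)}. \<pi> (i s) = j s"
    then show "order_semigroup S r2 =
        (\<lambda>A. matrix_inv (perm_mat \<pi>) ** A ** perm_mat \<pi>) ` order_semigroup S r1"
      by (rule order_semigroup_conjugate)
  next
    fix T1 T2 assume "T1 \<in> max_nilpotent (**) 0 S" "T2 \<in> max_nilpotent (**) 0 S"
    then show "semigroup_isomorphic (**) T1 T2" by (rule max_nilpotent_isomorphic)
  next
    fix k assume "1 \<le> k" "k < CARD('n)"
    then show "int (card (max_nilpotent_class (**) 0 S k)) =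
        (\<Sum>i=0..k-1. (-1) ^ i * int (k choose i) * (int k - int i) ^ CARD('n))"
      by (rule card_max_nilpotent_class[OF _ less_imp_le])
  next
    fix k assume "1 \<le> k" "k < CARD('n)"
    then show "bij_betw (block_semigroup S k) (ordered_decompositions k)
        (max_nilpotent_class (**) 0 S k)"
      by (rule bij_betw_block_semigroup[OF _ less_imp_le])
  next
    fix k and N :: "nat \<Rightarrow> 'n set" assume "1 \<le> k" "N \<in> ordered_decompositions k"
    then show "block_semigroup S k N \<in> max_nilpotent_class (**) 0 S k"
      by (rule block_semigroup_mem_max_nilpotent_class)
  qed
qed

end
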